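(* Let $S_1=(X_1,X_1,U_1,U_1,X_1,F_1,\mathrm{id})$ and $S_2=(X_2,X_2,U_2,U_2,X_2,F_2,\mathrm{id})$ be simple systems, and let $Q\subseteq X_1\times X_2$ be a strict relation. If for every system $C$ that is feedback composable with $S_2$ it follows that $C$ is feedback composable with $Q\circ S_1$ and that $\mathcal{B}(C\times(Q\circ S_1))\subseteq\mathcal{B}(C\times S_2)$ holds, then $Q$ is a feedback refinement relation from $S_1$ to $S_2$.
   Context: Notation. $\mathbb{N}=\{1,2,\dots\}$, $\mathbb{Z}_+=\{0,1,2,\dots\}$. For $T\in\mathbb{Z}_+\cup\{\infty\}$, $[0;T[\,=\{t\in\mathbb{Z}_+: t<T\}$; $A^{[0;T[}$ is the set of maps $[0;T[\,\to A$. $f\colon A\rightrightarrows B$ denotes a set-valued map, identified with the relation $\{(a,b): b\in f(a)\}\subseteq A\times B$; $f(M)=\bigcup_{a\in M}f(a)$ for $M\subseteq A$; $f$ is strict if $f(a)\neq\emptyset$ for all $a\in A$. Systems. A system is a septuple $S=(X,X_0,U,V,Y,F,H)$ where $X,X_0,U,V,Y$ are nonempty sets, $X_0\subseteq X$, $H\colon X\times U\rightrightarrows Y\times V$ is strict, and $F\colon X\times V\rightrightarrows X$. A solution of $S$ on $[0;T[$, $T\in\mathbb{N}\cup\{\infty\}$, is a quadruple $(u,v,x,y)\in U^{[0;T[}\times V^{[0;T[}\times X^{[0;T[}\times Y^{[0;T[}$ with $x(0)\in X_0$, $x(t+1)\in F(x(t),v(t))$ for all $t\in[0;T-1[$, and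 $(y(t),v(t))\in H(x(t),u(t))$ for all $t\in[0;T[$. $S$ is Moore if $(y,v)\in H(x,u)$ and $u'\in U$ imply that there is $v'$ with $(y,v')\in H(x,u')$. $S$ is simple if $U=V$, $X=Y$, $X_0=X$ and $H=\mathrm{id}$, i.e. $H(x,u)=\{(x,u)\}$. Behavior. $\mathcal{B}(S)$ is the set of pairs $(u,y)$ for which there exist $v,x,T$ such that $(u,v,x,y)$ is a solution of $S$ on $[0;T[$ and, if $T<\infty$, then $F(x(T-1),v(T-1))=\emptyset$. Serial composition with a quantizer. If $S=(X,X,U,U,X,F,\mathrm{id})$ is simple and $Q\colon X\rightrightarrows X'$ is strict, then $Q\circ S=(X,X,U,U,X',F,H')$ with $H'(x,u)=Q(x)\times\{u\}$. Feedback composition. Let $S_i=(X_i,X_{i,0},U_i,V_i,Y_i,F_i,H_i)$, $i\in\{1,2\}$, be systems. $S_1$ is feedback composable with $S_2$ if $S_2$ is Moore, $Y_2\subseteq U_1$, $Y_1\subseteq U_2$, and: whenever $(y_2,v_2)\in H_2(x_2,y_1)$, $(y_1,v_1)\in H_1(x_1,y_2)$ and $F_2(x_2,v_2)=\emptyset$, then $F_1(x_1,v_1)=\emptyset$. In that case the closed loop is $S_1\times S_2=(X_1\times X_2,X_{1,0}\times X_{2,0},\{0\},V_1\times V_2,Y_1\times Y_2,F_{12},H_{12})$ with $F_{12}(x,v)=F_1(x_1,v_1)\times F_2(x_2,v_2)$ and $H_{12}(x,0)=\{(y,v): (y_1,v_1)\in H_1(x_1,y_2)\wedge(y_2,v_2)\in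 H_2(x_2,y_1)\}$. Since its input alphabet is $\{0\}$, elements $(0,(y_1,y_2))$ of the behavior of $S_1\times S_2$ are identified with $(y_1,y_2)$. Feedback refinement relation. For a simple system $S$ put $U_S(x)=\{u\in U: F(x,u)\neq\emptyset\}$. For simple systems $S_i=(X_i,X_i,U_i,U_i,X_i,F_i,\mathrm{id})$, $i\in\{1,2\}$, a strict relation $Q\subseteq X_1\times X_2$ is a feedback refinement relation from $S_1$ to $S_2$ if $U_2\subseteq U_1$ and for all $(x_1,x_2)\in Q$: (1) $U_{S_2}(x_2)\subseteq U_{S_1}(x_1)$; (2) $u\in U_{S_2}(x_2)$ implies $Q(F_1(x_1,u))\subseteq F_2(x_2,u)$. *)

theory Defs
  imports "HOL-Library.Extended_Nat"
begin

(* Set-valued maps from A to B are represented by their graphs R \<subseteq> A \<times> B, so that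
   f(a) is R `` {a} and f(M) is R `` M. *)

(* In the generic definitions each alphabet has its own type.  Taking all these types equal to
   one type 'a turns 'a into a common universe of which all alphabets are subsets; quantifying
   over all ('a, 'a, 'a, 'a) system is then quantification over all systems in that universe. *)

definition strict_map :: "'a set \<Rightarrow> ('a \<times> 'b) set \<Rightarrow> bool" where
  "strict_map A R \<longleftrightarrow> (\<forall>a\<in>A. R `` {a} \<noteq> {})"

(* The septuple (X, X_0, U, V, Y, F, H). *)
record ('x, 'u, 'v, 'y) system =
  states :: "'x set"
  initials :: "'x set"
  inputs :: "'u set"
  internals :: "'v set"
  outputs :: "'y set"
  step :: "(('x \<times> 'v) \<times> 'x) set"
  outmap :: "(('x \<times> 'u) \<times> ('y \<times> 'v)) set"

definition is_system :: "('x, 'u, 'v, 'y) system \<Rightarrow> bool" where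
  "is_system S \<longleftrightarrow>
     states S \<noteq> {} \<and> initials S \<noteq> {} \<and> inputs S \<noteq> {} \<and> internals S \<noteq> {} \<and> outputs S \<noteq> {} \<and>
     initials S \<subseteq> states S \<and>
     step S \<subseteq> (states S \<times> internals S) \<times> states S \<and>
     outmap S \<subseteq> (states S \<times> inputs S) \<times> (outputs S \<times> internals S) \<and>
     strict_map (states S \<times> inputs S) (outmap S)"

definition moore :: "('x, 'u, 'v, 'y) system \<Rightarrow> bool" where
  "moore S \<longleftrightarrow>
     (\<forall>x u y v u'. (y, v) \<in> outmap S `` {(x, u)} \<and> u' \<in> inputs S \<longrightarrow>
        (\<exists>v'. (y, v') \<in> outmap S `` {(x, u')}))"

definition simple_system :: "('x, 'u, 'u, 'x) system \<Rightarrow> bool" where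
  "simple_system S \<longleftrightarrow>
     is_system S \<and> inputs S = internals S \<and> states S = outputs S \<and> initials S = states S \<and>
     outmap S = Id_on (states S \<times> inputs S)"

(* A^{[0;T[}.  Partial maps rather than extensional total functions: signals over
   different time domains have to be distinct. *)
definition signals :: "'a set \<Rightarrow> enat \<Rightarrow> (nat \<rightharpoonup> 'a) set" where
  "signals A T = {f. dom f = {t. enat t < T} \<and> ran f \<subseteq> A}"

definition is_solution ::
  "('x, 'u, 'v, 'y) system \<Rightarrow> enat \<Rightarrow>
     (nat \<rightharpoonup> 'u) \<Rightarrow> (nat \<rightharpoonup> 'v) \<Rightarrow> (nat \<rightharpoonup> 'x) \<Rightarrow> (nat \<rightharpoonup> 'y) \<Rightarrow> bool" where
  "is_solution S T u v x y \<longleftrightarrow>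
     T \<ge> 1 \<and>
     u \<in> signals (inputs S) T \<and> v \<in> signals (internals S) T \<and>
     x \<in> signals (states S) T \<and> y \<in> signals (outputs S) T \<and>
     the (x 0) \<in> initials S \<and>
     (\<forall>t. enat (t + 1) < T \<longrightarrow> the (x (t + 1)) \<in> step S `` {(the (x t), the (v t))}) \<and>
     (\<forall>t. enat t < T \<longrightarrow> (the (y t), the (v t)) \<in> outmap S `` {(the (x t), the (u t))})"

definition behavior :: "('x, 'u, 'v, 'y) system \<Rightarrow> ((nat \<rightharpoonup> 'u) \<times> (nat \<rightharpoonup> 'y)) set" where
  "behavior S = {(u, y). \<exists>v x T. is_solution S T u v x y \<and>
     (\<forall>n. T = enat n \<longrightarrow> step S `` {(the (x (n - 1)), the (v (n - 1)))} = {})}"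

(* The codomain X' of Q is an explicit argument, since the graph of Q does not determine it. *)
definition quantized ::
  "('x \<times> 'z) set \<Rightarrow> 'z set \<Rightarrow> ('x, 'u, 'u, 'x) system \<Rightarrow> ('x, 'u, 'u, 'z) system" where
  "quantized Q X' S =
     \<lparr>states = states S, initials = states S, inputs = inputs S, internals = inputs S,
      outputs = X', step = step S,
      outmap = {((x, u), (x', u')). x \<in> states S \<and> u \<in> inputs S \<and>
                                    (x', u') \<in> Q `` {x} \<times> {u}}\<rparr>"

definition feedback_composable ::
  "('x1, 'y2, 'v1, 'y1) system \<Rightarrow> ('x2, 'y1, 'v2, 'y2) system \<Rightarrow> bool" where
  "feedback_composable S1 S2 \<longleftrightarrow>
     moore S2 \<and> outputs S2 \<subseteq> inputs S1 \<and> outputs S1 \<subseteq> inputs S2 \<and>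
     (\<forall>x1 x2 y1 y2 v1 v2.
        (y2, v2) \<in> outmap S2 `` {(x2, y1)} \<and> (y1, v1) \<in> outmap S1 `` {(x1, y2)} \<and>
        step S2 `` {(x2, v2)} = {} \<longrightarrow> step S1 `` {(x1, v1)} = {})"

definition closed_loop ::
  "('x1, 'y2, 'v1, 'y1) system \<Rightarrow> ('x2, 'y1, 'v2, 'y2) system \<Rightarrow>
     ('x1 \<times> 'x2, nat, 'v1 \<times> 'v2, 'y1 \<times> 'y2) system" where
  "closed_loop S1 S2 =
     \<lparr>states = states S1 \<times> states S2, initials = initials S1 \<times> initials S2,
      inputs = {0}, internals = internals S1 \<times> internals S2,
      outputs = outputs S1 \<times> outputs S2,
      step = {(((x1, x2), (v1, v2)), (x1', x2')).
                (x1', x2') \<in> step S1 `` {(x1, v1)} \<times> step S2 `` {(x2, v2)}},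
      outmap = {(((x1, x2), w), ((y1, y2), (v1, v2))). w = 0 \<and>
                (y1, v1) \<in> outmap S1 `` {(x1, y2)} \<and> (y2, v2) \<in> outmap S2 `` {(x2, y1)}}\<rparr>"

definition enabled_inputs :: "('x, 'u, 'u, 'x) system \<Rightarrow> 'x \<Rightarrow> 'u set" where
  "enabled_inputs S x = {u \<in> inputs S. step S `` {(x, u)} \<noteq> {}}"

definition feedback_refinement ::
  "('x1 \<times> 'x2) set \<Rightarrow> ('x1, 'u, 'u, 'x1) system \<Rightarrow> ('x2, 'u, 'u, 'x2) system \<Rightarrow> bool" where
  "feedback_refinement Q S1 S2 \<longleftrightarrow>
     simple_system S1 \<and> simple_system S2 \<and>
     Q \<subseteq> states S1 \<times> states S2 \<and> strict_map (states S1) Q \<and>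
     inputs S2 \<subseteq> inputs S1 \<and>
     (\<forall>(x1, x2)\<in>Q.
        enabled_inputs S2 x2 \<subseteq> enabled_inputs S1 x1 \<and>
        (\<forall>u\<in>enabled_inputs S2 x2. Q `` (step S1 `` {(x1, u)}) \<subseteq> step S2 `` {(x2, u)}))"

end

theory Submission imports Defs begin

text \<open>
  The hypothesis quantifies over all controllers, but those with at most two states that play a
  single input \<open>u\<close> of \<open>S2\<close>, whatever they measure, already suffice (\<open>one_shot\<close>).
  Such a controller copies its measurement to its internal signal and makes a transition from its initial state
  exactly if \<open>S2\<close> enables \<open>u\<close> in the measured state. This is the most permissive transition guard for which it
  is composable with \<open>S2\<close>, and each clause of a feedback refinement relation can be read
  off from it.

  \<^item> Composability with \<open>Q \<circ> S1\<close> requires \<open>u\<close> to be an input of \<open>S1\<close>. It also requires the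
    controller to block wherever \<open>S1\<close> does. Since the controller does not block when it measures
    a state \<open>x2\<close> of \<open>S2\<close> enabling \<open>u\<close>, every \<open>x1\<close> related to \<open>x2\<close> enables \<open>u\<close> as well
    (\<open>enabled_of_one_shot_composable\<close>).

  \<^item> A transition of \<open>S1\<close> from \<open>x1\<close> to \<open>x1'\<close> under \<open>u\<close>, seen through \<open>Q\<close> as \<open>x2\<close> followed by
    \<open>x2'\<close>, is a complete run of the closed loop when the controller blocks after its first move
    (\<open>one_shot_run_in_behavior\<close>).
    By inclusion of behaviors it is also a run with \<open>S2\<close>, and since \<open>S2\<close> outputs its
    own state, it exhibits the transition of \<open>S2\<close> from \<open>x2\<close> to \<open>x2'\<close> under \<open>u\<close>
    (\<open>step_of_closed_loop_behavior\<close>).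

  Forcing the controller to stop takes two controller states, so the second argument needs a universe
  with more than one element; with only one element, \<open>x2'\<close> is the only possible successor.
\<close>

text \<open>
  Using the measured states themselves as internal signals avoids a separate pair of
  ``go'' and ``stop'' symbols, which a one-element universe could not supply.
  The states \<open>c0\<close> and \<open>c1\<close> are allowed to coincide; only if they are distinct is the
  controller forced to stop after one move.
\<close>
definition one_shot :: "('x, 'u, 'u, 'x) system \<Rightarrow> 'u \<Rightarrow> 'c \<Rightarrow> 'c \<Rightarrow> ('c, 'x, 'x, 'u) system" where
  "one_shot S u c0 c1 =
     \<lparr>states = {c0, c1}, initials = {c0}, inputs = states S, internals = states S, outputs = {u},
      step = {((c, x), c'). c = c0 \<and> c' = c1 \<and> x \<in> states S \<and> u \<in> enabled_inputs S x},
      outmap = {((c, x), (u', x')). c \<in> {c0, c1} \<and> x \<in> states S \<and> u' = u \<and> x' = x}\<rparr>"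

lemma is_system_one_shot:
  assumes "is_system S"
  shows "is_system (one_shot S u c0 c1)"
  using assms by (auto simp: is_system_def one_shot_def strict_map_def)

lemma simple_system_outmap_iff:
  assumes "simple_system S"
  shows "((x, u), (y, v)) \<in> outmap S \<longleftrightarrow> x \<in> states S \<and> u \<in> inputs S \<and> y = x \<and> v = u"
  using assms by (auto simp: simple_system_def)

lemma moore_simple_system:
  assumes "simple_system S"
  shows "moore S"
  using simple_system_outmap_iff[OF assms] by (auto simp: moore_def)

lemma feedback_composable_one_shot:
  assumes S: "simple_system S" and u: "u \<in> inputs S"
  shows "feedback_composable (one_shot S u c0 c1) S"
  using moore_simple_system[OF S] S u
  by (auto simp: feedback_composable_def one_shot_def simple_system_outmap_iff[OF S]
      simple_system_def enabled_inputs_def)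

text \<open>
  Composability forces the controller to block along with the quantized system; as it does
  not block at \<open>x2\<close>, neither can \<open>S1\<close> block at a state related to \<open>x2\<close>.
\<close>
lemma enabled_of_one_shot_composable:
  assumes comp: "feedback_composable (one_shot S2 u c0 c1) (quantized Q Z S1)"
    and Q: "(x1, x2) \<in> Q" "x1 \<in> states S1" "x2 \<in> states S2"
    and u: "u \<in> enabled_inputs S2 x2"
  shows "u \<in> enabled_inputs S1 x1"
proof -
  let ?C = "one_shot S2 u c0 c1" and ?P = "quantized Q Z S1"
  have u1: "u \<in> inputs S1"
    using comp by (auto simp: feedback_composable_def one_shot_def quantized_def)
  have "(x2, u) \<in> outmap ?P `` {(x1, u)}"
    using Q u1 by (auto simp: quantized_def)
  moreover have "(u, x2) \<in> outmap ?C `` {(c0, x2)}"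
    using Q by (auto simp: one_shot_def)
  moreover have "step ?C `` {(c0, x2)} \<noteq> {}"
    using Q u by (auto simp: one_shot_def)
  ultimately have "step ?P `` {(x1, u)} \<noteq> {}"
    using comp unfolding feedback_composable_def by blast
  then show ?thesis
    using u1 by (simp add: enabled_inputs_def quantized_def)
qed

lemma signals_two:
  assumes "a \<in> A" and "b \<in> A"
  shows "[0 \<mapsto> a, Suc 0 \<mapsto> b] \<in> signals A (enat 2)"
  using assms by (auto simp: signals_def)

text \<open>
  A solution over \<open>[0;2[\<close> belongs to the behavior only if the loop is blocked
  in its last state. The distinctness of \<open>c0\<close> and \<open>c1\<close> ensures this, whatever \<open>S1\<close> could still do.
\<close>
lemma one_shot_run_in_behavior:
  assumes S1: "simple_system S1" and c: "c0 \<noteq> c1"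
    and Q: "(x1, x2) \<in> Q" "(x1', x2') \<in> Q" "x2 \<in> states S2" "x2' \<in> states S2"
    and u1: "u \<in> inputs S1" and u: "u \<in> enabled_inputs S2 x2"
    and step: "((x1, u), x1') \<in> step S1"
  shows "([0 \<mapsto> 0, Suc 0 \<mapsto> 0], [0 \<mapsto> (u, x2), Suc 0 \<mapsto> (u, x2')])
           \<in> behavior (closed_loop (one_shot S2 u c0 c1) (quantized Q (states S2) S1))"
proof -
  let ?L = "closed_loop (one_shot S2 u c0 c1) (quantized Q (states S2) S1)"
  let ?w = "[0 \<mapsto> 0, Suc 0 \<mapsto> 0] :: nat \<rightharpoonup> nat"
  let ?v = "[0 \<mapsto> (x2, u), Suc 0 \<mapsto> (x2', u)]"
  let ?x = "[0 \<mapsto> (c0, x1), Suc 0 \<mapsto> (c1, x1')]"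
  let ?y = "[0 \<mapsto> (u, x2), Suc 0 \<mapsto> (u, x2')]"
  have st: "x1 \<in> states S1" "x1' \<in> states S1"
    using S1 step by (auto simp: simple_system_def is_system_def)
  have L: "inputs ?L = {0}" "internals ?L = states S2 \<times> inputs S1"
    "states ?L = {c0, c1} \<times> states S1" "outputs ?L = {u} \<times> states S2"
    "initials ?L = {c0} \<times> states S1"
    by (auto simp: closed_loop_def one_shot_def quantized_def)
  have move: "(((c0, x1), (x2, u)), (c1, x1')) \<in> step ?L"
    using Q u step by (auto simp: closed_loop_def one_shot_def quantized_def)
  have stop: "step ?L `` {((c1, x1'), (x2', u))} = {}"
    using c by (auto simp: closed_loop_def one_shot_def)
  have out: "(((c0, x1), 0), ((u, x2), (x2, u))) \<in> outmap ?L"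
    "(((c1, x1'), 0), ((u, x2'), (x2', u))) \<in> outmap ?L"
    using Q st u1 by (auto simp: closed_loop_def one_shot_def quantized_def)
  have "is_solution ?L (enat 2) ?w ?v ?x ?y"
    unfolding is_solution_def L
  proof (intro conjI allI impI)
    show "1 \<le> enat 2" by (simp add: one_enat_def)
    show "?w \<in> signals {0} (enat 2)" by (rule signals_two) auto
    show "?v \<in> signals (states S2 \<times> inputs S1) (enat 2)"
      by (rule signals_two) (use Q u1 in auto)
    show "?x \<in> signals ({c0, c1} \<times> states S1) (enat 2)"
      by (rule signals_two) (use st in auto)
    show "?y \<in> signals ({u} \<times> states S2) (enat 2)"
      by (rule signals_two) (use Q in auto)
    show "the (?x 0) \<in> {c0} \<times> states S1" using st by simp
  next
    fix t assume "enat (t + 1) < enat 2"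
    then have "t = 0" by simp
    then show "the (?x (t + 1)) \<in> step ?L `` {(the (?x t), the (?v t))}"
      using move by simp
  next
    fix t assume "enat t < enat 2"
    then have "t = 0 \<or> t = Suc 0" by auto
    then show "(the (?y t), the (?v t)) \<in> outmap ?L `` {(the (?x t), the (?w t))}"
      using out by auto
  qed
  then show ?thesis
    using stop unfolding behavior_def by (auto intro!: exI[of _ "enat 2"] exI[of _ ?v] exI[of _ ?x])
qed

text \<open>
  The plant is simple, so its states are visible in its outputs and its input is the
  controller's output; hence the external signals of the loop determine the plant's transitions.
\<close>
lemma step_of_closed_loop_behavior:
  assumes S: "simple_system S"
    and beh: "(w, y) \<in> behavior (closed_loop C S)"
    and y: "y t = Some (a, x)" "y (Suc t) = Some (b, x')"
  shows "((x, a), x') \<in> step S"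
proof -
  from beh obtain v z T where sol: "is_solution (closed_loop C S) T w v z y"
    unfolding behavior_def by blast
  have "dom y = {t. enat t < T}"
    using sol by (simp add: is_solution_def signals_def)
  moreover have "t \<in> dom y" "Suc t \<in> dom y"
    using y by auto
  ultimately have T: "enat t < T" "enat (Suc t) < T"
    by auto
  obtain c p d q where z: "the (z t) = (c, p)" "the (z (Suc t)) = (d, q)"
    by (meson surj_pair)
  obtain r i s j where v: "the (v t) = (r, i)" "the (v (Suc t)) = (s, j)"
    by (meson surj_pair)
  have out: "(the (y k), the (v k)) \<in> outmap (closed_loop C S) `` {(the (z k), the (w k))}"
    if "enat k < T" for k
    using sol that by (simp add: is_solution_def)
  have "((p, a), (x, i)) \<in> outmap S" "((q, b), (x', j)) \<in> outmap S"
    using out[OF T(1)] out[OF T(2)] y z v by (auto simp: closed_loop_def)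
  then have "p = x" "i = a" "q = x'"
    by (auto simp: simple_system_outmap_iff[OF S])
  moreover have "the (z (Suc t)) \<in> step (closed_loop C S) `` {(the (z t), the (v t))}"
    using sol T by (simp add: is_solution_def)
  then have "((p, i), q) \<in> step S"
    using z v by (simp add: closed_loop_def)
  ultimately show ?thesis by simp
qed

theorem theoremV5:
  fixes S1 S2 :: "('a, 'a, 'a, 'a) system"
    and Q :: "('a \<times> 'a) set"
  assumes "simple_system S1" and "simple_system S2"
    and "Q \<subseteq> states S1 \<times> states S2" and "strict_map (states S1) Q"
    and "\<And>C :: ('a, 'a, 'a, 'a) system.
           is_system C \<Longrightarrow> feedback_composable C S2 \<Longrightarrow>
             feedback_composable C (quantized Q (states S2) S1) \<and>
             behavior (closed_loop C (quantized Q (states S2) S1)) \<subseteq> behavior (closed_loop C S2)"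
  shows "feedback_refinement Q S1 S2"
proof -
  let ?P = "quantized Q (states S2) S1"
  have sys2: "is_system S2"
    using assms(2) by (simp add: simple_system_def)
  have comp: "feedback_composable (one_shot S2 u c0 c1) ?P"
    and incl: "behavior (closed_loop (one_shot S2 u c0 c1) ?P)
                 \<subseteq> behavior (closed_loop (one_shot S2 u c0 c1) S2)"
    if "u \<in> inputs S2" for u c0 c1 :: 'a
    using assms(5)[OF is_system_one_shot[OF sys2, of u c0 c1]
        feedback_composable_one_shot[OF assms(2) that, of c0 c1]]
    by simp_all
  have inputs: "inputs S2 \<subseteq> inputs S1"
    using comp by (auto simp: feedback_composable_def one_shot_def quantized_def)
  have enabled: "u \<in> enabled_inputs S1 x1"
    if "(x1, x2) \<in> Q" "u \<in> enabled_inputs S2 x2" for x1 x2 u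
  proof -
    have "u \<in> inputs S2" using that by (simp add: enabled_inputs_def)
    then show ?thesis
      using enabled_of_one_shot_composable[OF comp] that assms(3) by blast
  qed
  have succ: "((x2, u), x2') \<in> step S2"
    if Q: "(x1, x2) \<in> Q" "(x1', x2') \<in> Q"
      and u: "u \<in> enabled_inputs S2 x2" and step: "((x1, u), x1') \<in> step S1"
    for x1 x2 u x1' x2'
  proof (cases "\<exists>c. c \<noteq> x2")
    case True
    then obtain c where c: "x2 \<noteq> c" by metis
    have u2: "u \<in> inputs S2" using u by (simp add: enabled_inputs_def)
    have "([0 \<mapsto> 0, Suc 0 \<mapsto> 0], [0 \<mapsto> (u, x2), Suc 0 \<mapsto> (u, x2')])
            \<in> behavior (closed_loop (one_shot S2 u x2 c) ?P)"
      by (rule one_shot_run_in_behavior[OF assms(1) c]) (use Q u u2 step inputs assms(3) in auto)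
    then have "([0 \<mapsto> 0, Suc 0 \<mapsto> 0], [0 \<mapsto> (u, x2), Suc 0 \<mapsto> (u, x2')])
            \<in> behavior (closed_loop (one_shot S2 u x2 c) S2)"
      using incl[OF u2] by blast
    from step_of_closed_loop_behavior[OF assms(2) this, where t = 0] show ?thesis
      by simp
  next
    case False
    from u obtain z where "((x2, u), z) \<in> step S2"
      by (auto simp: enabled_inputs_def)
    moreover have "z = x2'" using False by metis
    ultimately show ?thesis by simp
  qed
  show ?thesis
    using assms(1-4) inputs enabled succ by (auto simp: feedback_refinement_def)
qed

end
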